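(* Let $\mathcal{J}:\mathbb{R}^n\to\mathbb{R}\cup\{\infty\}$ be proper, coercive, lower semi-continuous, and continuous on its domain, with convex $\operatorname{dom}\mathcal{J}$, and let $V\subset\mathbb{R}^n$ be a linear subspace. Assume that at least one of the following holds: (a) $\mathcal{J}$ is block-separable nonsmooth with respect to some $R=(R_1,\dots,R_m)$, and the subspace decomposition is induced by the block structure, so that $V=(\ker R_k)^\perp$ for some $k$; (b) $\operatorname{dom}\mathcal{J}$ is a convex polyhedron. For $w\in\operatorname{dom}\mathcal{J}$ let $\mathcal{M}^{\mathrm{ex}}(w)$ be a (any) global minimizer of $\mathcal{J}$ in $w+V$. Let $\mathcal{M}:\operatorname{dom}\mathcal{J}\to\operatorname{dom}\mathcal{J}$ be a map with $\mathcal{M}(w)-w\in V$ for all $w\in\operatorname{dom}\mathcal{J}$ that satisfies the sufficient descent condition $$\mathcal{J}(w)-\mathcal{J}(\mathcal{M}(w))\ge\varepsilon\bigl[\mathcal{J}(w)-\mathcal{J}(\mathcal{M}^{\mathrm{ex}}(w))\bigr]\qquad\forall w\in\operatorname{dom}\mathcal{J}$$ for a fixed $\varepsilon>0$. Then there exists a map $\tilde{\mathcal{M}}:\operatorname{dom}\mathcal{J}\to\operatorname{dom}\mathcal{J}$ with $\tilde{\mathcal{M}}(w)-w\in V$ for all $w\in\operatorname{dom}\mathcal{J}$ such that: 1. (Monotonicity) $\mathcal{J}(\mathcal{M}(w))\le\mathcal{J}(\tilde{\mathcal{M}}(w))\le\mathcal{J}(w)$ for all $w\in\operatorname{dom}\mathcal{J}$;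 2. (Continuity) $\mathcal{J}\circ\tilde{\mathcal{M}}$ is continuous on $\operatorname{dom}\mathcal{J}$; 3. (Stability) $\mathcal{J}(\tilde{\mathcal{M}}(w))<\mathcal{J}(w)$ for every $w\in\operatorname{dom}\mathcal{J}$ such that $\mathcal{J}(w)$ is not minimal in $w+V$.
   Context: $\operatorname{dom}\mathcal{J}=\{x : \mathcal{J}(x)<\infty\}$, with the topology induced from $\mathbb{R}^n$. Coercive means $\mathcal{J}(v)\to\infty$ as $\|v\|\to\infty$. "Continuous on its domain" means that the restriction of $\mathcal{J}$ to $\operatorname{dom}\mathcal{J}$ is continuous. Block-separable nonsmooth: $R=(R_1,\dots,R_m):\mathbb{R}^n\to\prod_{k=1}^m\mathbb{R}^{N_k}$ is a linear isomorphism with surjective linear components $R_k:\mathbb{R}^n\to\mathbb{R}^{N_k}$; and there are a continuously differentiable $\mathcal{J}_0:\mathbb{R}^n\to\mathbb{R}$ and convex, proper, lower semi-continuous $\varphi_k:\mathbb{R}^{N_k}\to\mathbb{R}\cup\{\infty\}$ with $\mathcal{J}(v)=\mathcal{J}_0(v)+\sum_{k=1}^m\varphi_k(R_kv)$ for all $v\in\mathbb{R}^n$. A convex polyhedron is a (not necessarily closed) set of the form $\{x\in\mathbb{R}^n : \langle b_i,x\rangle\lhd_i c_i,\ i=1,\dots,l\}$, where each $\lhd_i$ is either $<$ or $\le$.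
   Formalization: In case (a) it is additionally required that R_j vanishes on V for every j ≠ k (automatic for coordinate blocks); with only V = (ker R_k)^⊥ and a general linear isomorphism R the claim is false. *)

theory Defs
  imports "HOL-Analysis.Analysis"
begin

definition effective_domain :: "('a \<Rightarrow> ereal) \<Rightarrow> 'a set"
  where "effective_domain f = {x. f x < \<infinity>}"

(* Functions into R \<union> {\<infinity>} are ereal-valued functions; properness includes that the
   value -\<infinity> is never attained. *)
definition proper_on :: "'a set \<Rightarrow> ('a \<Rightarrow> ereal) \<Rightarrow> bool"
  where "proper_on S f \<longleftrightarrow> (\<forall>x\<in>S. f x \<noteq> -\<infinity>) \<and> (\<exists>x\<in>S. f x < \<infinity>)"

definition lower_semicontinuous :: "'a topology \<Rightarrow> ('a \<Rightarrow> ereal) \<Rightarrow> bool"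
  where "lower_semicontinuous X f \<longleftrightarrow> (\<forall>x\<in>topspace X. f x \<le> Liminf (nhdsin X x) f)"

definition coercive :: "('a::real_normed_vector \<Rightarrow> ereal) \<Rightarrow> bool"
  where "coercive f \<longleftrightarrow> (f \<longlongrightarrow> \<infinity>) at_infinity"

definition continuously_differentiable :: "('a::real_normed_vector \<Rightarrow> real) \<Rightarrow> bool"
  where "continuously_differentiable f \<longleftrightarrow>
    (\<exists>f' :: 'a \<Rightarrow> 'a \<Rightarrow>\<^sub>L real.
       (\<forall>x. (f has_derivative blinfun_apply (f' x)) (at x)) \<and> continuous_on UNIV f')"

(* The spaces R^{N_k} have dimensions depending on the block index k. They are therefore the
   carriers of the library topologies Euclidean_space (N k), i.e. the x :: nat \<Rightarrow> real with
   x i = 0 for all i \<ge> N k, and their vector space operations are pointwise. *)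

definition ereal_convex_on :: "(nat \<Rightarrow> real) set \<Rightarrow> ((nat \<Rightarrow> real) \<Rightarrow> ereal) \<Rightarrow> bool"
  where "ereal_convex_on S f \<longleftrightarrow>
    (\<forall>x\<in>S. \<forall>y\<in>S. \<forall>t. 0 < t \<and> t < 1 \<longrightarrow>
       f (\<lambda>i. (1 - t) * x i + t * y i) \<le> ereal (1 - t) * f x + ereal t * f y)"

definition block_structure ::
  "nat \<Rightarrow> (nat \<Rightarrow> nat) \<Rightarrow> (nat \<Rightarrow> real^'n \<Rightarrow> nat \<Rightarrow> real) \<Rightarrow> bool"
  where "block_structure m N R \<longleftrightarrow>
    (\<forall>k\<in>{1..m}. (\<forall>i. linear (\<lambda>v. R k v i)) \<and> range (R k) = topspace (Euclidean_space (N k))) \<and>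
    bij_betw (\<lambda>v. \<lambda>k\<in>{1..m}. R k v) UNIV (\<Pi>\<^sub>E k\<in>{1..m}. topspace (Euclidean_space (N k)))"

definition block_separable_nonsmooth ::
  "nat \<Rightarrow> (nat \<Rightarrow> nat) \<Rightarrow> (nat \<Rightarrow> real^'n \<Rightarrow> nat \<Rightarrow> real) \<Rightarrow> (real^'n \<Rightarrow> ereal) \<Rightarrow> bool"
  where "block_separable_nonsmooth m N R J \<longleftrightarrow>
    block_structure m N R \<and>
    (\<exists>(J0 :: real^'n \<Rightarrow> real) (\<phi> :: nat \<Rightarrow> (nat \<Rightarrow> real) \<Rightarrow> ereal).
       continuously_differentiable J0 \<and>
       (\<forall>k\<in>{1..m}.
          ereal_convex_on (topspace (Euclidean_space (N k))) (\<phi> k) \<and>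
          proper_on (topspace (Euclidean_space (N k))) (\<phi> k) \<and>
          lower_semicontinuous (Euclidean_space (N k)) (\<phi> k)) \<and>
       (\<forall>v. J v = ereal (J0 v) + (\<Sum>k=1..m. \<phi> k (R k v))))"

definition block_kernel :: "(nat \<Rightarrow> real^'n \<Rightarrow> nat \<Rightarrow> real) \<Rightarrow> nat \<Rightarrow> (real^'n) set"
  where "block_kernel R k = {v. R k v = (\<lambda>i. 0)}"

(* V is the k-th subspace of the decomposition induced by the block structure: V is the orthogonal
   complement of ker R_k, and it is the part of R^n belonging to the k-th block, i.e. moving along
   V does not change the other blocks. The second conjunct is automatic when the R_k select
   disjoint groups of coordinates. For a general isomorphism R it is not: it says that
   (ker R_k)^\<bottom> is orthogonal to every other (ker R_j)^\<bottom>. Without it, V would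
   have no relation to the product structure of the effective domain. *)
definition induced_by_block ::
  "nat \<Rightarrow> (nat \<Rightarrow> real^'n \<Rightarrow> nat \<Rightarrow> real) \<Rightarrow> nat \<Rightarrow> (real^'n) set \<Rightarrow> bool"
  where "induced_by_block m R k V \<longleftrightarrow>
    V = orthogonal_comp (block_kernel R k) \<and>
    (\<forall>j\<in>{1..m}. j \<noteq> k \<longrightarrow> V \<subseteq> block_kernel R j)"

(* Unlike the library's polyhedron, this need not be closed. *)
definition convex_polyhedron :: "'a::real_inner set \<Rightarrow> bool"
  where "convex_polyhedron S \<longleftrightarrow>
    (\<exists>(l::nat) (b :: nat \<Rightarrow> 'a) (c :: nat \<Rightarrow> real) (strict :: nat \<Rightarrow> bool).
       S = {x. \<forall>i\<in>{1..l}. if strict i then b i \<bullet> x < c i else b i \<bullet> x \<le> c i})"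

end

theory Submission
  imports Defs
begin

text \<open>
  Let \<open>h w\<close> be the minimum of \<open>J\<close> on \<open>w + V\<close>. Either hypothesis on the domain \<open>D\<close> makes the
  slices \<open>D \<inter> (w + V)\<close> depend lower hemicontinuously on \<open>w \<in> D\<close>, so that \<open>h\<close> is upper
  semicontinuous and the gap \<open>\<epsilon> (J - h)\<close> is lower semicontinuous. Its Lipschitz regularisation
  \<open>q w = inf\<^sub>y (\<epsilon> (J y - h y) + dist w y)\<close> is continuous, lies below the gap, and is positive where the
  gap is. By the intermediate value theorem on the segment from \<open>w\<close> to \<open>M w\<close>, the value \<open>J w - q w\<close>
  is attained by \<open>J\<close>.
\<close>

section \<open>Continuous minorants of a gap, and descent maps built from them\<close>

text \<open>From lower semicontinuity only \<open>pos\<close> is kept: near a point of positive gap,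
  the gap stays away from zero. One number \<open>e\<close> can be both radius and bound because
  distance and gap are added inside the infimum.\<close>

lemma continuous_minorant:
  fixes g :: "'a::metric_space \<Rightarrow> real"
  assumes nonneg: "\<And>x. x \<in> D \<Longrightarrow> 0 \<le> g x"
    and pos: "\<And>w. w \<in> D \<Longrightarrow> 0 < g w \<Longrightarrow> \<exists>e>0. \<forall>x\<in>D. dist x w < e \<longrightarrow> e \<le> g x"
  obtains q where "continuous_on D q" and "\<And>w. w \<in> D \<Longrightarrow> 0 \<le> q w" and "\<And>w. w \<in> D \<Longrightarrow> q w \<le> g w"
    and "\<And>w. w \<in> D \<Longrightarrow> 0 < g w \<Longrightarrow> 0 < q w"
proof
  define q where "q w = (INF y\<in>D. g y + dist w y)" for w
  have bdd: "bdd_below ((\<lambda>y. g y + dist w y) ` D)" for w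
    using nonneg by (intro bdd_belowI[of _ 0]) auto
  have le: "q w \<le> g y + dist w y" if "y \<in> D" for w y
    unfolding q_def by (rule cINF_lower[OF bdd that])
  have ge: "c \<le> q w" if "w \<in> D" "\<And>y. y \<in> D \<Longrightarrow> c \<le> g y + dist w y" for w c
    unfolding q_def using that by (intro cINF_greatest) auto
  show "q w \<le> g w" if "w \<in> D" for w
    using le[OF that, of w] by simp
  show "0 \<le> q w" if "w \<in> D" for w
    using nonneg by (intro ge that) auto
  show "0 < q w" if w: "w \<in> D" "0 < g w" for w
  proof -
    obtain e where e: "e > 0" "\<And>x. x \<in> D \<Longrightarrow> dist x w < e \<Longrightarrow> e \<le> g x"
      using pos[OF w] by auto
    \<comment> \<open>Within distance \<open>e\<close> of \<open>w\<close> the term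
      \<open>g y\<close> supplies the bound; farther away \<open>dist w y\<close> does, as
      \<open>g y\<close> is nonnegative.\<close>
    have "e \<le> g y + dist w y" if "y \<in> D" for y
      using e(2)[OF that] nonneg[OF that] zero_le_dist[of w y]
      by (cases "dist y w < e") (auto simp: dist_commute simp del: zero_le_dist)
    then have "e \<le> q w" by (intro ge w)
    with e(1) show ?thesis by simp
  qed
  \<comment> \<open>An infimum of functions that are 1-Lipschitz in \<open>w\<close> is again
    1-Lipschitz.\<close>
  have lip: "q w \<le> q x + dist w x" if "x \<in> D" for w x
  proof -
    have "q w - dist w x \<le> g y + dist x y" if "y \<in> D" for y
      using le[OF that, of w] dist_triangle[of w y x] by simp
    then have "q w - dist w x \<le> q x" by (intro ge that)
    then show ?thesis by simp
  qed
  have "dist (q x) (q w) \<le> 1 * dist x w" if "x \<in> D" "w \<in> D" for x w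
    using lip[OF that(1), of w] lip[OF that(2), of x] by (simp add: dist_real_def dist_commute abs_le_iff)
  then have "1-lipschitz_on D q" by (intro lipschitz_onI) auto
  then show "continuous_on D q" by (rule lipschitz_on_continuous_on)
qed

lemma convex_ivt_closed_segment:
  fixes f :: "'a::real_normed_vector \<Rightarrow> real"
  assumes "convex D" "continuous_on D f" "a \<in> D" "b \<in> D" "f b \<le> c" "c \<le> f a"
  obtains x where "x \<in> closed_segment a b" "x \<in> D" "f x = c"
proof -
  have sub: "closed_segment a b \<subseteq> D"
    using assms by (simp add: closed_segment_subset)
  then have "connected (f ` closed_segment a b)"
    using assms by (intro connected_continuous_image connected_segment) (auto intro: continuous_on_subset)
  then have "{f b..f a} \<subseteq> f ` closed_segment a b"
    by (rule connected_contains_Icc) auto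
  then have "c \<in> f ` closed_segment a b" using assms by auto
  then show thesis using that sub by auto
qed

lemma closed_segment_diff_subspace:
  assumes "subspace V" "b - a \<in> V" "x \<in> closed_segment a b"
  shows "x - a \<in> V"
proof -
  obtain u where "x = (1 - u) *\<^sub>R a + u *\<^sub>R b"
    using assms(3) by (auto simp: closed_segment_def)
  then have "x - a = u *\<^sub>R (b - a)" by (simp add: algebra_simps)
  then show ?thesis using assms by (simp add: subspace_scale)
qed

text \<open>The points \<open>M' w\<close> are chosen one by one, with no continuity of
  \<open>M'\<close> itself. Since their values are prescribed exactly as \<open>f w - q w\<close>,
  the composition with \<open>f\<close> is continuous all the same.\<close>

lemma continuous_descent_from_gap:
  fixes f g :: "'a::real_normed_vector \<Rightarrow> real"
  assumes D: "convex D" "continuous_on D f" and V: "subspace V"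
    and M: "\<And>w. w \<in> D \<Longrightarrow> M w \<in> D" "\<And>w. w \<in> D \<Longrightarrow> M w - w \<in> V"
    and descent: "\<And>w. w \<in> D \<Longrightarrow> f (M w) \<le> f w - g w"
    and nonneg: "\<And>x. x \<in> D \<Longrightarrow> 0 \<le> g x"
    and pos: "\<And>w. w \<in> D \<Longrightarrow> 0 < g w \<Longrightarrow> \<exists>e>0. \<forall>x\<in>D. dist x w < e \<longrightarrow> e \<le> g x"
  obtains M' where "\<And>w. w \<in> D \<Longrightarrow> M' w \<in> D" "\<And>w. w \<in> D \<Longrightarrow> M' w - w \<in> V"
    "\<And>w. w \<in> D \<Longrightarrow> f (M w) \<le> f (M' w)" "\<And>w. w \<in> D \<Longrightarrow> f (M' w) \<le> f w"
    "continuous_on D (\<lambda>w. f (M' w))" "\<And>w. w \<in> D \<Longrightarrow> 0 < g w \<Longrightarrow> f (M' w) < f w"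
proof -
  obtain q where q: "continuous_on D q" "\<And>w. w \<in> D \<Longrightarrow> 0 \<le> q w" "\<And>w. w \<in> D \<Longrightarrow> q w \<le> g w"
    "\<And>w. w \<in> D \<Longrightarrow> 0 < g w \<Longrightarrow> 0 < q w"
    using continuous_minorant[of D g] nonneg pos by metis
  have "\<exists>x. x \<in> D \<and> x - w \<in> V \<and> f x = f w - q w" if w: "w \<in> D" for w
  proof -
    have "f (M w) \<le> f w - q w" "f w - q w \<le> f w"
      using descent[OF w] q(2,3)[OF w] by auto
    then obtain x where "x \<in> closed_segment w (M w)" "x \<in> D" "f x = f w - q w"
      using convex_ivt_closed_segment[OF D w M(1)[OF w]] by blast
    then show ?thesis
      using closed_segment_diff_subspace[OF V M(2)[OF w]] by blast
  qed
  then obtain M' where M': "\<And>w. w \<in> D \<Longrightarrow> M' w \<in> D \<and> M' w - w \<in> V \<and> f (M' w) = f w - q w"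
    by metis
  have "continuous_on D (\<lambda>w. f w - q w)"
    using D(2) q(1) by (rule continuous_on_diff)
  then have "continuous_on D (\<lambda>w. f (M' w))"
    using M' by (simp cong: continuous_on_cong)
  moreover have "f (M w) \<le> f (M' w)" if "w \<in> D" for w
    using M'[OF that] descent[OF that] q(3)[OF that] by simp
  ultimately show thesis
    using that[of M'] M' q(2,4) by auto
qed

section \<open>Lower hemicontinuity of slices and its effect on the gap\<close>

text \<open>This is lower hemicontinuity, in \<epsilon>-\<delta> form and relative to
  \<open>D\<close>, of the set-valued map that sends \<open>x\<close> to the intersection of
  \<open>D\<close> with \<open>x + V\<close>.\<close>

definition lower_hemicontinuous_slices :: "'a::real_normed_vector set \<Rightarrow> 'a set \<Rightarrow> bool"
  where "lower_hemicontinuous_slices D V \<longleftrightarrow>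
    (\<forall>w\<in>D. \<forall>y\<in>D. y - w \<in> V \<longrightarrow>
       (\<forall>e>0. \<exists>d>0. \<forall>x\<in>D. dist x w < d \<longrightarrow> (\<exists>z\<in>D. z - x \<in> V \<and> dist z y < e)))"

text \<open>A better point \<open>y\<close> in the slice of \<open>w\<close> has counterparts
  \<open>z\<close> close to it in all slices of nearby \<open>x\<close>. Continuity keeps
  \<open>f z\<close> near \<open>f y\<close>, which bounds \<open>h x\<close> from above.\<close>

lemma lower_hemicontinuous_slices_gap:
  fixes f h :: "'a::real_normed_vector \<Rightarrow> real"
  assumes slices: "lower_hemicontinuous_slices D V" and f: "continuous_on D f"
    and w: "w \<in> D" "y \<in> D" "y - w \<in> V" "f y < f w"
    and h: "\<And>x z. x \<in> D \<Longrightarrow> z \<in> D \<Longrightarrow> z - x \<in> V \<Longrightarrow> h x \<le> f z"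
  shows "\<exists>\<eta>>0. \<exists>d>0. \<forall>x\<in>D. dist x w < d \<longrightarrow> \<eta> \<le> f x - h x"
proof -
  \<comment> \<open>Moving from \<open>w\<close> to \<open>x\<close> and from \<open>y\<close> to
    \<open>z\<close> costs less than one third each, so one third of the gap survives.\<close>
  define \<eta> where "\<eta> = (f w - f y) / 3"
  have \<eta>: "\<eta> > 0" using w by (simp add: \<eta>_def)
  obtain d1 where d1: "d1 > 0" "\<And>x. x \<in> D \<Longrightarrow> dist x w < d1 \<Longrightarrow> dist (f x) (f w) < \<eta>"
    using f w(1) \<eta> unfolding continuous_on_iff by meson
  obtain e where e: "e > 0" "\<And>z. z \<in> D \<Longrightarrow> dist z y < e \<Longrightarrow> dist (f z) (f y) < \<eta>"
    using f w(2) \<eta> unfolding continuous_on_iff by meson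
  obtain d2 where d2: "d2 > 0"
    "\<And>x. x \<in> D \<Longrightarrow> dist x w < d2 \<Longrightarrow> \<exists>z\<in>D. z - x \<in> V \<and> dist z y < e"
    using slices w e(1) unfolding lower_hemicontinuous_slices_def by meson
  have "\<eta> \<le> f x - h x" if x: "x \<in> D" "dist x w < min d1 d2" for x
  proof -
    obtain z where z: "z \<in> D" "z - x \<in> V" "dist z y < e"
      using d2(2) x by auto
    have "\<bar>f x - f w\<bar> < \<eta>" "\<bar>f z - f y\<bar> < \<eta>"
      using d1(2) x e(2) z by (auto simp: dist_real_def)
    moreover have "f w - f y = 3 * \<eta>" by (simp add: \<eta>_def)
    ultimately show ?thesis using h[OF x(1) z(1,2)] by linarith
  qed
  moreover have "min d1 d2 > 0" using d1 d2 by simp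
  ultimately show ?thesis using \<eta> by blast
qed

section \<open>Polyhedral domains\<close>

text \<open>The full step from \<open>w\<close> to \<open>y\<close>, repeated from a nearby
  \<open>x\<close>, may violate a constraint that is slack at \<open>w\<close> and tight at
  \<open>y\<close>. A slightly shorter step respects each constraint near \<open>w\<close>, and
  finitely many constraints share a neighbourhood.\<close>

lemma lower_hemicontinuous_slices_polyhedron:
  fixes D :: "'a::real_inner set"
  assumes D: "convex_polyhedron D" and V: "subspace V"
  shows "lower_hemicontinuous_slices D V"
  unfolding lower_hemicontinuous_slices_def
proof (intro ballI impI allI)
  fix w y and e :: real
  assume w: "w \<in> D" and y: "y \<in> D" and "y - w \<in> V" and "e > 0"
  define v where "v = y - w"
  have v: "v \<in> V" "y = w + v" using \<open>y - w \<in> V\<close> by (auto simp: v_def)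
  obtain l b c strict where D_def: "D = {x. \<forall>i\<in>{1..l::nat}. if strict i then b i \<bullet> x < c i else b i \<bullet> x \<le> c i}"
    using D unfolding convex_polyhedron_def by blast
  \<comment> \<open>The shortening \<open>s\<close> must be positive to gain slack, yet small enough
    that the shortened step from \<open>w\<close> ends within \<open>e\<close> of
    \<open>y\<close>.\<close>
  have "((\<lambda>s::real. norm (s *\<^sub>R v)) \<longlongrightarrow> norm (0 *\<^sub>R v)) (at_right 0)"
    by (intro tendsto_intros)
  then have "\<forall>\<^sub>F s in at_right 0. norm (s *\<^sub>R v) < e"
    using \<open>e > 0\<close> by (intro order_tendstoD) auto
  moreover have "\<forall>\<^sub>F s in at_right 0. (0::real) < s \<and> s < 1"
    using eventually_at_right_real[of 0 1] by simp
  ultimately have "\<forall>\<^sub>F s in at_right 0. norm (s *\<^sub>R v) < e \<and> 0 < s \<and> s < 1"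
    by eventually_elim auto
  then obtain s :: real where s: "norm (s *\<^sub>R v) < e" "0 < s" "s < 1"
    using eventually_happens by fastforce
  \<comment> \<open>Shrinking the step from \<open>v\<close> to \<open>(1 - s) v\<close> keeps every constraint that is slack at \<open>w\<close> or \<open>y\<close>
    slack, and the remaining ones have normals orthogonal to \<open>v\<close>.\<close>
  define z where "z x = x + (1 - s) *\<^sub>R v" for x
  have "\<forall>\<^sub>F x in nhds w. x \<in> D \<longrightarrow> (if strict i then b i \<bullet> z x < c i else b i \<bullet> z x \<le> c i)"
    if i: "i \<in> {1..l}" for i
  proof -
    have le: "b i \<bullet> w \<le> c i" "b i \<bullet> w + b i \<bullet> v \<le> c i"
      using bspec[OF w[unfolded D_def mem_Collect_eq] i] bspec[OF y[unfolded D_def mem_Collect_eq] i]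
      by (auto simp: v inner_add_right split: if_splits)
    show ?thesis
    proof (cases "b i \<bullet> w = c i \<and> b i \<bullet> v = 0")
      case True
      then have "b i \<bullet> z x = b i \<bullet> x" for x by (simp add: z_def inner_add_right)
      then show ?thesis using i by (auto simp: D_def)
    next
      case False
      \<comment> \<open>\<open>z w\<close> is a convex combination of \<open>w\<close> and
        \<open>y\<close> with positive weights, so strictness at either endpoint is
        inherited.\<close>
      have eq: "b i \<bullet> z w = s * (b i \<bullet> w) + (1 - s) * (b i \<bullet> w + b i \<bullet> v)"
        by (simp add: z_def inner_add_right algebra_simps)
      have "b i \<bullet> z w < c i"
      proof (cases "b i \<bullet> w < c i")
        case True
        then have "s * (b i \<bullet> w) < s * c i" "(1 - s) * (b i \<bullet> w + b i \<bullet> v) \<le> (1 - s) * c i"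
          using s le by (auto intro: mult_left_mono)
        then show ?thesis unfolding eq by (simp add: algebra_simps)
      next
        case False
        with le \<open>\<not> (b i \<bullet> w = c i \<and> b i \<bullet> v = 0)\<close> have "b i \<bullet> w + b i \<bullet> v < c i" by auto
        then have "s * (b i \<bullet> w) \<le> s * c i" "(1 - s) * (b i \<bullet> w + b i \<bullet> v) < (1 - s) * c i"
          using s le by (auto intro: mult_left_mono)
        then show ?thesis unfolding eq by (simp add: algebra_simps)
      qed
      moreover have "((\<lambda>x. b i \<bullet> z x) \<longlongrightarrow> b i \<bullet> z w) (nhds w)"
        unfolding z_def by (intro tendsto_intros filterlim_ident)
      ultimately have "\<forall>\<^sub>F x in nhds w. b i \<bullet> z x < c i"
        by (auto dest: order_tendstoD)
      then show ?thesis by eventually_elim auto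
    qed
  qed
  then have "\<forall>\<^sub>F x in nhds w. \<forall>i\<in>{1..l}. x \<in> D \<longrightarrow> (if strict i then b i \<bullet> z x < c i else b i \<bullet> z x \<le> c i)"
    by (intro eventually_ball_finite) auto
  then have "\<forall>\<^sub>F x in nhds w. x \<in> D \<longrightarrow> z x \<in> D"
    by eventually_elim (unfold D_def, blast)
  moreover have "\<forall>\<^sub>F x in nhds w. dist (z x) y < e"
  proof (rule order_tendstoD)
    show "((\<lambda>x. dist (z x) y) \<longlongrightarrow> dist (z w) y) (nhds w)"
      unfolding z_def by (intro tendsto_intros filterlim_ident)
    have "z w - y = - (s *\<^sub>R v)" by (simp add: z_def v algebra_simps)
    then show "dist (z w) y < e" using s(1) by (simp add: dist_norm)
  qed
  ultimately have "\<forall>\<^sub>F x in nhds w. (x \<in> D \<longrightarrow> z x \<in> D) \<and> dist (z x) y < e"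
    by (rule eventually_conj)
  then obtain d where "d > 0" "\<And>x. dist x w < d \<Longrightarrow> (x \<in> D \<longrightarrow> z x \<in> D) \<and> dist (z x) y < e"
    unfolding eventually_nhds_metric by auto
  moreover have "z x - x \<in> V" for x
    using V v by (simp add: z_def subspace_scale)
  ultimately show "\<exists>d>0. \<forall>x\<in>D. dist x w < d \<longrightarrow> (\<exists>z\<in>D. z - x \<in> V \<and> dist z y < e)"
    by blast
qed

section \<open>Block-separable domains\<close>

lemma subspace_block_kernel:
  assumes "\<And>i. linear (\<lambda>v. R k v i)"
  shows "subspace (block_kernel R k)"
proof -
  have "block_kernel R k = (\<Inter>i. {v. R k v i = 0})"
    by (auto simp: block_kernel_def)
  then show ?thesis
    using assms by (auto intro!: subspace_Inter linear_subspace_kernel)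
qed

lemma block_add_kernel:
  assumes "\<And>i. linear (\<lambda>v. R k v i)" "u \<in> block_kernel R k"
  shows "R k (x + u) = R k x"
  using assms linear_add[OF assms(1), of x u] by (auto simp: block_kernel_def)

text \<open>A finite sum in \<open>ereal\<close> is \<infinity> exactly when some summand is, by the
  convention that \<infinity> absorbs -\<infinity>. Membership is thus tested block by
  block.\<close>

lemma effective_domain_block_separable:
  assumes "\<And>v. J v = ereal (J0 v) + (\<Sum>k=1..m. \<phi> k (R k v))"
  shows "x \<in> effective_domain J \<longleftrightarrow> (\<forall>k\<in>{1..m::nat}. \<phi> k (R k x) \<noteq> \<infinity>)"
  unfolding effective_domain_def using assms by (auto simp: less_top[symmetric] top_ereal_def sum_Pinfty)

text \<open>Split \<open>x - w\<close> into \<open>p\<close> in \<open>V\<close> and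
  \<open>q\<close> orthogonal to \<open>V\<close>. Then \<open>y + q\<close> lies in
  \<open>x + V\<close>, with block \<open>k\<close> taken from \<open>y\<close> and the other blocks
  from \<open>x\<close>, hence in the domain. As \<open>q\<close> is no longer than
  \<open>x - w\<close>, the radius \<open>e\<close> itself works.\<close>

lemma lower_hemicontinuous_slices_block:
  fixes J :: "real^'n \<Rightarrow> ereal"
  assumes J: "block_separable_nonsmooth m N R J" and k: "k \<in> {1..m}"
    and ind: "induced_by_block m R k V"
  shows "lower_hemicontinuous_slices (effective_domain J) V"
  unfolding lower_hemicontinuous_slices_def
proof (intro ballI impI allI)
  fix w y and e :: real
  assume w: "w \<in> effective_domain J" and y: "y \<in> effective_domain J" and yw: "y - w \<in> V" and "e > 0"
  obtain J0 \<phi> where J_eq: "\<And>v. J v = ereal (J0 v) + (\<Sum>k=1..m. \<phi> k (R k v))"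
    using J unfolding block_separable_nonsmooth_def by blast
  have dom: "x \<in> effective_domain J \<longleftrightarrow> (\<forall>k\<in>{1..m}. \<phi> k (R k x) \<noteq> \<infinity>)" for x
    using effective_domain_block_separable[of J J0 \<phi> R m x] J_eq by blast
  have lin: "linear (\<lambda>v. R j v i)" if "j \<in> {1..m}" for j i
    using J that unfolding block_separable_nonsmooth_def block_structure_def by blast
  have V: "V = orthogonal_comp (block_kernel R k)"
    and others: "\<And>j. j \<in> {1..m} \<Longrightarrow> j \<noteq> k \<Longrightarrow> V \<subseteq> block_kernel R j"
    using ind unfolding induced_by_block_def by auto
  have subV: "subspace V" unfolding V by (rule subspace_orthogonal_comp)
  have compV: "orthogonal_comp V = block_kernel R k"
    unfolding V by (intro orthogonal_comp_self subspace_block_kernel lin k)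
  have "\<exists>z\<in>effective_domain J. z - x \<in> V \<and> dist z y < e"
    if x: "x \<in> effective_domain J" "dist x w < e" for x
  proof -
    obtain p q where pq: "x - w = p + q" "p \<in> V" "q \<in> orthogonal_comp V"
      using subspace_sum_orthogonal_comp[OF subV] by (metis UNIV_I set_plus_elim)
    then have "orthogonal p q" by (simp add: orthogonal_comp_def)
    then have "(norm (x - w))\<^sup>2 = (norm p)\<^sup>2 + (norm q)\<^sup>2"
      unfolding pq(1) by (rule norm_add_Pythagorean)
    then have "norm q \<le> norm (x - w)" by (auto intro: power2_le_imp_le[of "norm q" "norm (x - w)"])
    then have "dist (y + q) y < e" using x(2) by (simp add: dist_norm)
    moreover have diff: "y + q - x \<in> V"
    proof -
      have "y + q - x = (y - w) - p" using pq(1) by (simp add: algebra_simps)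
      then show ?thesis using subspace_diff[OF subV yw pq(2)] by (simp only:)
    qed
    moreover have "y + q \<in> effective_domain J"
      unfolding dom
    proof
      fix j assume j: "j \<in> {1..m}"
      show "\<phi> j (R j (y + q)) \<noteq> \<infinity>"
      proof (cases "j = k")
        case True
        then have "R j (y + q) = R j y"
          using pq(3) compV by (intro block_add_kernel lin j) simp
        then show ?thesis using y dom j by metis
      next
        case False
        \<comment> \<open>Here the second conjunct of \<open>induced_by_block\<close> enters: moving
          along \<open>V\<close> leaves block \<open>j\<close> fixed.\<close>
        then have "R j (x + (y + q - x)) = R j x"
          using others[OF j] diff by (intro block_add_kernel lin j) auto
        then have "R j (y + q) = R j x" by simp
        then show ?thesis using x(1) dom j by metis
      qed
    qed
    ultimately show ?thesis by blast
  qed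
  with \<open>e > 0\<close> show "\<exists>d>0. \<forall>x\<in>effective_domain J. dist x w < d \<longrightarrow>
      (\<exists>z\<in>effective_domain J. z - x \<in> V \<and> dist z y < e)"
    by blast
qed

section \<open>Passage to real values and construction of the descent map\<close>

theorem lemma5p3:
  fixes J :: "real^'n \<Rightarrow> ereal"
    and V :: "(real^'n) set"
    and M Mex :: "real^'n \<Rightarrow> real^'n"
    and \<epsilon> :: real
  assumes "proper_on UNIV J"
    and "coercive J"
    and "lower_semicontinuous euclidean J"
    and "continuous_on (effective_domain J) J"
    and "convex (effective_domain J)"
    and "subspace V"
    and "(\<exists>m N R. block_separable_nonsmooth m N R J \<and> (\<exists>k\<in>{1..m}. induced_by_block m R k V))
         \<or> convex_polyhedron (effective_domain J)"
    and "\<And>w. w \<in> effective_domain J \<Longrightarrow> is_arg_min J (\<lambda>y. y \<in> (+) w ` V) (Mex w)"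
    and "\<And>w. w \<in> effective_domain J \<Longrightarrow> M w \<in> effective_domain J"
    and "\<And>w. w \<in> effective_domain J \<Longrightarrow> M w - w \<in> V"
    and "\<epsilon> > 0"
    and "\<And>w. w \<in> effective_domain J \<Longrightarrow> J w - J (M w) \<ge> ereal \<epsilon> * (J w - J (Mex w))"
  shows "\<exists>M' :: real^'n \<Rightarrow> real^'n.
           (\<forall>w\<in>effective_domain J. M' w \<in> effective_domain J \<and> M' w - w \<in> V) \<and>
           (\<forall>w\<in>effective_domain J. J (M w) \<le> J (M' w) \<and> J (M' w) \<le> J w) \<and>
           continuous_on (effective_domain J) (J \<circ> M') \<and>
           (\<forall>w\<in>effective_domain J. \<not> is_arg_min J (\<lambda>y. y \<in> (+) w ` V) w \<longrightarrow> J (M' w) < J w)"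
proof -
  define D where "D = effective_domain J"
  \<comment> \<open>\<open>real_of_ereal\<close> sends infinite values to 0, so \<open>f\<close>
    represents \<open>J\<close> only on \<open>D\<close>.\<close>
  define f where "f x = real_of_ereal (J x)" for x
  define g where "g w = \<epsilon> * (f w - f (Mex w))" for w
  have fin: "J x = ereal (f x)" if "x \<in> D" for x
    using that assms(1) unfolding D_def f_def effective_domain_def proper_on_def
    by (cases "J x") auto
  have coset: "y \<in> (+) w ` V \<longleftrightarrow> y - w \<in> V" for w y
    by (force simp: image_iff)
  have Mex: "Mex w \<in> D" "Mex w - w \<in> V" and h: "\<And>z. z \<in> D \<Longrightarrow> z - w \<in> V \<Longrightarrow> f (Mex w) \<le> f z"
    if w: "w \<in> D" for w
  proof -
    have V: "Mex w - w \<in> V" and min: "\<And>z. z - w \<in> V \<Longrightarrow> J (Mex w) \<le> J z"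
      using assms(8)[of w] w unfolding is_arg_min_def coset D_def by (auto simp: not_less)
    show "Mex w - w \<in> V" by (rule V)
    \<comment> \<open>\<open>w\<close> competes in its own coset, so the minimal value is below
      \<infinity>.\<close>
    have "J (Mex w) \<le> J w" using assms(6) by (intro min) (simp add: subspace_0)
    then show "Mex w \<in> D" using w by (auto simp: D_def effective_domain_def)
    then show "f (Mex w) \<le> f z" if "z \<in> D" "z - w \<in> V" for z
      using min[OF that(2)] fin that(1) by simp
  qed
  have self: "w - w \<in> V" for w using assms(6) by (simp add: subspace_0)
  have contf: "continuous_on D f"
  proof -
    have "continuous_on D (real_of_ereal \<circ> J)"
      using assms(4) fin by (subst continuous_on_iff_real[symmetric]) (auto simp: D_def)
    then show ?thesis by (simp add: f_def[abs_def] o_def)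
  qed
  have slices: "lower_hemicontinuous_slices D V"
    using assms(6,7) lower_hemicontinuous_slices_block lower_hemicontinuous_slices_polyhedron
    unfolding D_def by blast
  have M: "M w \<in> D" "M w - w \<in> V" if "w \<in> D" for w
    using assms(9,10) that unfolding D_def by auto
  have descent: "f (M w) \<le> f w - g w" if w: "w \<in> D" for w
    using assms(12)[of w] w fin[OF w] fin[OF M(1)[OF w]] fin[OF Mex(1)[OF w]]
    by (simp add: D_def g_def)
  have nonneg: "0 \<le> g w" if "w \<in> D" for w
    using h[OF that that self] assms(11) by (simp add: g_def)
  have pos: "\<exists>e>0. \<forall>x\<in>D. dist x w < e \<longrightarrow> e \<le> g x" if w: "w \<in> D" "0 < g w" for w
  proof -
    have "f (Mex w) < f w" using w(2) assms(11) by (simp add: g_def zero_less_mult_iff)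
    then obtain \<eta> d where \<eta>: "\<eta> > 0" "d > 0" "\<And>x. x \<in> D \<Longrightarrow> dist x w < d \<Longrightarrow> \<eta> \<le> f x - f (Mex x)"
      using lower_hemicontinuous_slices_gap[OF slices contf w(1) Mex[OF w(1)] _, of "\<lambda>x. f (Mex x)"] h
      by blast
    \<comment> \<open>The minimum merges the bound and the radius into the single number that
      \<open>pos\<close> asks for.\<close>
    have "min (\<epsilon> * \<eta>) d \<le> g x" if "x \<in> D" "dist x w < min (\<epsilon> * \<eta>) d" for x
    proof -
      have "\<epsilon> * \<eta> \<le> g x"
        unfolding g_def using \<eta>(3)[of x] that assms(11) by (intro mult_left_mono) auto
      then show ?thesis by simp
    qed
    moreover have "min (\<epsilon> * \<eta>) d > 0" using \<eta> assms(11) by simp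
    ultimately show ?thesis by blast
  qed
  obtain M' where M': "\<And>w. w \<in> D \<Longrightarrow> M' w \<in> D" "\<And>w. w \<in> D \<Longrightarrow> M' w - w \<in> V"
    "\<And>w. w \<in> D \<Longrightarrow> f (M w) \<le> f (M' w)" "\<And>w. w \<in> D \<Longrightarrow> f (M' w) \<le> f w"
    "continuous_on D (\<lambda>w. f (M' w))" "\<And>w. w \<in> D \<Longrightarrow> 0 < g w \<Longrightarrow> f (M' w) < f w"
    using continuous_descent_from_gap[of D f V M g]
      assms(5)[folded D_def] contf assms(6) M descent nonneg pos by blast
  have "continuous_on D (J \<circ> M')"
  proof -
    have "continuous_on D (\<lambda>w. ereal (f (M' w)))"
      using M'(5) by (rule continuous_on_ereal)
    then show ?thesis using fin M'(1) by (simp add: o_def cong: continuous_on_cong)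
  qed
  moreover have "J (M' w) < J w" if w: "w \<in> D" "\<not> is_arg_min J (\<lambda>y. y \<in> (+) w ` V) w" for w
  proof -
    \<comment> \<open>A strictly better competitor has a value below \<infinity>, so it lies in
      \<open>D\<close>; \<open>Mex w\<close> does at least as well, which makes the gap
      positive.\<close>
    obtain y where y: "y - w \<in> V" "J y < J w"
      using w(2) self unfolding is_arg_min_def coset by blast
    then have "y \<in> D" using w(1) by (auto simp: D_def effective_domain_def)
    then have "f (Mex w) < f w"
      using y h[OF w(1) _ y(1)] fin w(1) by fastforce
    then have "0 < g w" using assms(11) by (simp add: g_def)
    then show ?thesis using M'(1,6) w(1) fin by simp
  qed
  ultimately show ?thesis
    unfolding D_def[symmetric] using M' M fin by (intro exI[of _ M']) auto
qed

end
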